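(* Let $\mathcal{M}$ be a symmetric Minkowski plane, let $p,q$ be points with $p\notin[q]_1\cup[q]_2$, and let $I,J,K$ be circles each containing both $p$ and $q$. Then there exists a circle $L$ containing $p$ and $q$ such that $S_L=S_K\circ S_J\circ S_I$.
   Context: A hyperbola structure is a triple $\mathcal{M}=(\mathcal{P},\Lambda,\Sigma_1\cup\Sigma_2)$, where $\mathcal{P}$ is a nonempty set (points) and $\Lambda,\Sigma_1,\Sigma_2$ are nonempty sets of subsets of $\mathcal{P}$ with $\Sigma_1\cap\Sigma_2=\emptyset$ (elements of $\Lambda$ are circles, elements of $\Sigma_1\cup\Sigma_2$ are generators), such that: (H1) for each point $p$ and $i\in\{1,2\}$ there is exactly one $G\in\Sigma_i$ with $p\in G$, denoted $[p]_i$; (H2) any $A\in\Sigma_1$ and $B\in\Sigma_2$ meet in exactly one point; (H3) every generator meets every circle in exactly one point; (H4) for any three distinct points $a,b,c$ with $[a]_i\neq[b]_i\neq[c]_i\neq[a]_i$ for $i=1,2$ there is exactly one circle containing $a,b,c$; (H5) some circle contains at least three points. For points $p,q$, $pq$ denotes the unique point of $[p]_1\cap[q]_2$. For a circle $K$, the circle symmetry $S_K:\mathcal{P}\to\mathcal{P}$ sends $p$ to the unique point $q$ with $pq\in K$ and $qp\in K$. Two distinct circles $K,L$ are orthogonal ($K\perp L$) if $S_K(p)=p$ for every $p\in L$. Symmetry axiom (S): for any circles $K,L$ and any point $p\in L\setminus K$, if $S_K(p)\in L$ then $K\perp L$. A symmetric Minkowski plane is a hyperbola structure satisfying (S).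
   Formalization: Orthogonality of distinct circles K, L is taken as S_K(L)=L (L fixed as a set) instead of S_K(p)=p for every p in L; with pointwise fixing, axiom (S) contradicts (H1)–(H5), so no symmetric Minkowski plane would exist. *)

theory Defs imports Main
begin

text \<open>Points are the elements of a carrier set \<open>P\<close>; \<open>\<Lambda>\<close> is the set of circles and
  \<open>\<Sigma>\<^sub>1\<close>, \<open>\<Sigma>\<^sub>2\<close> are the two sets of generators.\<close>

text \<open>\<open>gen_through \<Sigma>\<^sub>i p\<close> is $[p]_i$ and \<open>corner \<Sigma>\<^sub>1 \<Sigma>\<^sub>2 p q\<close> is the point written $pq$.\<close>

definition gen_through :: "'a set set \<Rightarrow> 'a \<Rightarrow> 'a set"
  where "gen_through \<Sigma> p = (THE G. G \<in> \<Sigma> \<and> p \<in> G)"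

definition corner :: "'a set set \<Rightarrow> 'a set set \<Rightarrow> 'a \<Rightarrow> 'a \<Rightarrow> 'a"
  where "corner \<Sigma>\<^sub>1 \<Sigma>\<^sub>2 p q = (THE x. x \<in> gen_through \<Sigma>\<^sub>1 p \<inter> gen_through \<Sigma>\<^sub>2 q)"

text \<open>The symmetry $S_K$; it is meaningful only for arguments in \<open>P\<close>
  (see \<open>circle_sym_ex1\<close> below).\<close>

definition circle_sym :: "'a set \<Rightarrow> 'a set set \<Rightarrow> 'a set set \<Rightarrow> 'a set \<Rightarrow> 'a \<Rightarrow> 'a"
  where "circle_sym P \<Sigma>\<^sub>1 \<Sigma>\<^sub>2 K p =
    (THE q. q \<in> P \<and> corner \<Sigma>\<^sub>1 \<Sigma>\<^sub>2 p q \<in> K \<and> corner \<Sigma>\<^sub>1 \<Sigma>\<^sub>2 q p \<in> K)"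

text \<open>The circle \<open>L\<close> is fixed by $S_K$ as a set. It cannot be required to be fixed pointwise: the
  fixed points of $S_K$ are the points of \<open>K\<close>, and the symmetry axiom would become
  contradictory (see \<open>pointwise_symmetry_axiom_inconsistent\<close> below).\<close>

definition orthogonal ::
    "'a set \<Rightarrow> 'a set set \<Rightarrow> 'a set set \<Rightarrow> 'a set \<Rightarrow> 'a set \<Rightarrow> bool"
  where "orthogonal P \<Sigma>\<^sub>1 \<Sigma>\<^sub>2 K L \<longleftrightarrow> K \<noteq> L \<and> circle_sym P \<Sigma>\<^sub>1 \<Sigma>\<^sub>2 K ` L = L"

locale hyperbola_structure =
  fixes P :: "'a set" and \<Lambda> \<Sigma>\<^sub>1 \<Sigma>\<^sub>2 :: "'a set set"
  assumes points_nonempty: "P \<noteq> {}"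
    and circles_nonempty: "\<Lambda> \<noteq> {}"
    and gens1_nonempty: "\<Sigma>\<^sub>1 \<noteq> {}"
    and gens2_nonempty: "\<Sigma>\<^sub>2 \<noteq> {}"
    and circles_subset: "\<Lambda> \<subseteq> Pow P"
    and gens1_subset: "\<Sigma>\<^sub>1 \<subseteq> Pow P"
    and gens2_subset: "\<Sigma>\<^sub>2 \<subseteq> Pow P"
    and gens_disjoint: "\<Sigma>\<^sub>1 \<inter> \<Sigma>\<^sub>2 = {}"
    and H1: "\<And>p \<Sigma>. p \<in> P \<Longrightarrow> \<Sigma> \<in> {\<Sigma>\<^sub>1, \<Sigma>\<^sub>2} \<Longrightarrow> \<exists>!G. G \<in> \<Sigma> \<and> p \<in> G"
    and H2: "\<And>A B. A \<in> \<Sigma>\<^sub>1 \<Longrightarrow> B \<in> \<Sigma>\<^sub>2 \<Longrightarrow> \<exists>!x. x \<in> A \<inter> B"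
    and H3: "\<And>G K. G \<in> \<Sigma>\<^sub>1 \<union> \<Sigma>\<^sub>2 \<Longrightarrow> K \<in> \<Lambda> \<Longrightarrow> \<exists>!x. x \<in> G \<inter> K"
    and H4: "\<And>a b c. \<lbrakk>a \<in> P; b \<in> P; c \<in> P; a \<noteq> b; b \<noteq> c; c \<noteq> a;
          \<forall>\<Sigma> \<in> {\<Sigma>\<^sub>1, \<Sigma>\<^sub>2}. gen_through \<Sigma> a \<noteq> gen_through \<Sigma> b \<and>
            gen_through \<Sigma> b \<noteq> gen_through \<Sigma> c \<and> gen_through \<Sigma> c \<noteq> gen_through \<Sigma> a\<rbrakk>
        \<Longrightarrow> \<exists>!K. K \<in> \<Lambda> \<and> a \<in> K \<and> b \<in> K \<and> c \<in> K"
    and H5: "\<exists>K\<in>\<Lambda>. \<exists>a\<in>K. \<exists>b\<in>K. \<exists>c\<in>K. a \<noteq> b \<and> b \<noteq> c \<and> c \<noteq> a"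

locale symmetric_minkowski_plane = hyperbola_structure +
  assumes symmetry: "\<And>K L p. \<lbrakk>K \<in> \<Lambda>; L \<in> \<Lambda>; p \<in> L - K; circle_sym P \<Sigma>\<^sub>1 \<Sigma>\<^sub>2 K p \<in> L\<rbrakk>
        \<Longrightarrow> orthogonal P \<Sigma>\<^sub>1 \<Sigma>\<^sub>2 K L"

context hyperbola_structure
begin

lemma gen1: "p \<in> P \<Longrightarrow> gen_through \<Sigma>\<^sub>1 p \<in> \<Sigma>\<^sub>1 \<and> p \<in> gen_through \<Sigma>\<^sub>1 p"
  unfolding gen_through_def using theI'[OF H1[of p \<Sigma>\<^sub>1]] by simp

lemma gen2: "p \<in> P \<Longrightarrow> gen_through \<Sigma>\<^sub>2 p \<in> \<Sigma>\<^sub>2 \<and> p \<in> gen_through \<Sigma>\<^sub>2 p"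
  unfolding gen_through_def using theI'[OF H1[of p \<Sigma>\<^sub>2]] by simp

lemma gen1_eq: "p \<in> P \<Longrightarrow> G \<in> \<Sigma>\<^sub>1 \<Longrightarrow> p \<in> G \<Longrightarrow> gen_through \<Sigma>\<^sub>1 p = G"
  using H1[of p \<Sigma>\<^sub>1] gen1 by blast

lemma gen2_eq: "p \<in> P \<Longrightarrow> G \<in> \<Sigma>\<^sub>2 \<Longrightarrow> p \<in> G \<Longrightarrow> gen_through \<Sigma>\<^sub>2 p = G"
  using H1[of p \<Sigma>\<^sub>2] gen2 by blast

lemma corner:
  assumes "p \<in> P" "q \<in> P"
  shows corner_in: "corner \<Sigma>\<^sub>1 \<Sigma>\<^sub>2 p q \<in> P"
    and corner_gen1: "gen_through \<Sigma>\<^sub>1 (corner \<Sigma>\<^sub>1 \<Sigma>\<^sub>2 p q) = gen_through \<Sigma>\<^sub>1 p"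
    and corner_gen2: "gen_through \<Sigma>\<^sub>2 (corner \<Sigma>\<^sub>1 \<Sigma>\<^sub>2 p q) = gen_through \<Sigma>\<^sub>2 q"
proof -
  have m: "corner \<Sigma>\<^sub>1 \<Sigma>\<^sub>2 p q \<in> gen_through \<Sigma>\<^sub>1 p \<inter> gen_through \<Sigma>\<^sub>2 q"
    unfolding corner_def
    by (rule theI'[OF H2]) (use gen1 gen2 assms in blast)+
  show P: "corner \<Sigma>\<^sub>1 \<Sigma>\<^sub>2 p q \<in> P"
    using m gen1[OF assms(1)] gens1_subset by blast
  show "gen_through \<Sigma>\<^sub>1 (corner \<Sigma>\<^sub>1 \<Sigma>\<^sub>2 p q) = gen_through \<Sigma>\<^sub>1 p"
    using gen1_eq[OF P] gen1[OF assms(1)] m by blast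
  show "gen_through \<Sigma>\<^sub>2 (corner \<Sigma>\<^sub>1 \<Sigma>\<^sub>2 p q) = gen_through \<Sigma>\<^sub>2 q"
    using gen2_eq[OF P] gen2[OF assms(2)] m by blast
qed

lemma point_eqI:
  assumes "p \<in> P" "q \<in> P" "gen_through \<Sigma>\<^sub>1 p = gen_through \<Sigma>\<^sub>1 q"
    "gen_through \<Sigma>\<^sub>2 p = gen_through \<Sigma>\<^sub>2 q"
  shows "p = q"
proof -
  have "p \<in> gen_through \<Sigma>\<^sub>1 p \<inter> gen_through \<Sigma>\<^sub>2 p" using gen1 gen2 assms(1) by blast
  moreover have "q \<in> gen_through \<Sigma>\<^sub>1 p \<inter> gen_through \<Sigma>\<^sub>2 p"
    using gen1[OF assms(2)] gen2[OF assms(2)] assms(3,4) by simp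
  ultimately show ?thesis using H2 gen1[OF assms(1)] gen2[OF assms(1)] by blast
qed

lemma circle_point_eqI:
  assumes "K \<in> \<Lambda>" "p \<in> K" "q \<in> K"
    "gen_through \<Sigma>\<^sub>1 p = gen_through \<Sigma>\<^sub>1 q \<or> gen_through \<Sigma>\<^sub>2 p = gen_through \<Sigma>\<^sub>2 q"
  shows "p = q"
proof -
  have P: "p \<in> P" "q \<in> P" using assms circles_subset by auto
  obtain G where G: "G \<in> \<Sigma>\<^sub>1 \<union> \<Sigma>\<^sub>2" "p \<in> G" "q \<in> G"
    using assms(4) gen1[OF P(1)] gen1[OF P(2)] gen2[OF P(1)] gen2[OF P(2)] by auto
  then show ?thesis using H3[OF G(1) assms(1)] assms(2,3) by blast
qed

lemma circle_sym_ex1: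
  assumes K: "K \<in> \<Lambda>" and p: "p \<in> P"
  shows "\<exists>!q. q \<in> P \<and> corner \<Sigma>\<^sub>1 \<Sigma>\<^sub>2 p q \<in> K \<and> corner \<Sigma>\<^sub>1 \<Sigma>\<^sub>2 q p \<in> K"
proof -
  obtain u where u: "u \<in> gen_through \<Sigma>\<^sub>1 p" "u \<in> K" using H3[OF UnI1 K] gen1[OF p] by blast
  obtain v where v: "v \<in> gen_through \<Sigma>\<^sub>2 p" "v \<in> K" using H3[OF UnI2 K] gen2[OF p] by blast
  have P: "u \<in> P" "v \<in> P" using u v K circles_subset by auto
  have gu: "gen_through \<Sigma>\<^sub>1 u = gen_through \<Sigma>\<^sub>1 p" using gen1_eq[OF P(1)] u gen1[OF p] by simp
  have gv: "gen_through \<Sigma>\<^sub>2 v = gen_through \<Sigma>\<^sub>2 p" using gen2_eq[OF P(2)] v gen2[OF p] by simp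
  let ?q = "corner \<Sigma>\<^sub>1 \<Sigma>\<^sub>2 v u"
  have q: "?q \<in> P" using corner_in P by blast
  have "corner \<Sigma>\<^sub>1 \<Sigma>\<^sub>2 p ?q = u"
    by (rule point_eqI) (use p q P gu in \<open>simp_all add: corner\<close>)
  moreover have "corner \<Sigma>\<^sub>1 \<Sigma>\<^sub>2 ?q p = v"
    by (rule point_eqI) (use p q P gv in \<open>simp_all add: corner\<close>)
  moreover have "r = ?q" if r: "r \<in> P" "corner \<Sigma>\<^sub>1 \<Sigma>\<^sub>2 p r \<in> K" "corner \<Sigma>\<^sub>1 \<Sigma>\<^sub>2 r p \<in> K" for r
  proof -
    have "corner \<Sigma>\<^sub>1 \<Sigma>\<^sub>2 p r = u"
      by (rule circle_point_eqI[OF K]) (use r u gu p in \<open>simp_all add: corner\<close>)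
    moreover have "corner \<Sigma>\<^sub>1 \<Sigma>\<^sub>2 r p = v"
      by (rule circle_point_eqI[OF K]) (use r v gv p in \<open>simp_all add: corner\<close>)
    ultimately have "gen_through \<Sigma>\<^sub>2 r = gen_through \<Sigma>\<^sub>2 u" "gen_through \<Sigma>\<^sub>1 r = gen_through \<Sigma>\<^sub>1 v"
      using corner_gen2[OF p r(1)] corner_gen1[OF r(1) p] by simp_all
    then show ?thesis using point_eqI[OF r(1) q] P by (simp add: corner)
  qed
  ultimately show ?thesis using q u(2) v(2) by (metis (no_types, lifting))
qed

lemma circle_sym_eqI:
  assumes "K \<in> \<Lambda>" "p \<in> P" "q \<in> P" "corner \<Sigma>\<^sub>1 \<Sigma>\<^sub>2 p q \<in> K" "corner \<Sigma>\<^sub>1 \<Sigma>\<^sub>2 q p \<in> K"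
  shows "circle_sym P \<Sigma>\<^sub>1 \<Sigma>\<^sub>2 K p = q"
  unfolding circle_sym_def
  by (rule the1_equality[OF circle_sym_ex1[OF assms(1,2)]]) (use assms in blast)

lemma circle_sym_fixed_iff:
  assumes K: "K \<in> \<Lambda>" and p: "p \<in> P"
  shows "circle_sym P \<Sigma>\<^sub>1 \<Sigma>\<^sub>2 K p = p \<longleftrightarrow> p \<in> K"
proof -
  have pp: "corner \<Sigma>\<^sub>1 \<Sigma>\<^sub>2 p p = p" by (rule point_eqI) (use p in \<open>simp_all add: corner\<close>)
  show ?thesis
    using theI'[OF circle_sym_ex1[OF K p], folded circle_sym_def] circle_sym_eqI[OF K p p] pp
    by auto
qed

lemma pointwise_symmetry_axiom_inconsistent:
  assumes S: "\<And>K L p. \<lbrakk>K \<in> \<Lambda>; L \<in> \<Lambda>; p \<in> L - K; circle_sym P \<Sigma>\<^sub>1 \<Sigma>\<^sub>2 K p \<in> L\<rbrakk>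
        \<Longrightarrow> K \<noteq> L \<and> (\<forall>x\<in>L. circle_sym P \<Sigma>\<^sub>1 \<Sigma>\<^sub>2 K x = x)"
  shows False
proof -
  obtain K a b c where K: "K \<in> \<Lambda>" and abc: "a \<in> K" "b \<in> K" "c \<in> K" "a \<noteq> b" "b \<noteq> c" "c \<noteq> a"
    using H5 by blast
  have P: "a \<in> P" "b \<in> P" "c \<in> P" using K abc circles_subset by auto
  have g1: "gen_through \<Sigma>\<^sub>1 a \<noteq> gen_through \<Sigma>\<^sub>1 b" "gen_through \<Sigma>\<^sub>1 b \<noteq> gen_through \<Sigma>\<^sub>1 c"
    "gen_through \<Sigma>\<^sub>1 c \<noteq> gen_through \<Sigma>\<^sub>1 a" using abc circle_point_eqI[OF K] by blast+
  have g2: "gen_through \<Sigma>\<^sub>2 a \<noteq> gen_through \<Sigma>\<^sub>2 b" "gen_through \<Sigma>\<^sub>2 b \<noteq> gen_through \<Sigma>\<^sub>2 c"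
    "gen_through \<Sigma>\<^sub>2 c \<noteq> gen_through \<Sigma>\<^sub>2 a" using abc circle_point_eqI[OF K] by blast+
  let ?p = "corner \<Sigma>\<^sub>1 \<Sigma>\<^sub>2 a b" and ?q = "corner \<Sigma>\<^sub>1 \<Sigma>\<^sub>2 b a"
  have pq: "?p \<in> P" "?q \<in> P" using corner_in P by blast+
  have G: "\<forall>\<Sigma>\<in>{\<Sigma>\<^sub>1, \<Sigma>\<^sub>2}. gen_through \<Sigma> ?p \<noteq> gen_through \<Sigma> ?q \<and>
      gen_through \<Sigma> ?q \<noteq> gen_through \<Sigma> c \<and> gen_through \<Sigma> c \<noteq> gen_through \<Sigma> ?p"
    using g1 g2 P by (auto simp: corner)
  then have "?p \<noteq> ?q" "?q \<noteq> c" "c \<noteq> ?p" by auto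
  then obtain L where L: "L \<in> \<Lambda>" "?p \<in> L" "?q \<in> L"
    using ex1_implies_ex[OF H4[OF pq P(3) _ _ _ G]] by blast
  have "corner \<Sigma>\<^sub>1 \<Sigma>\<^sub>2 ?p ?q = a" by (rule point_eqI) (use P pq in \<open>simp_all add: corner\<close>)
  moreover have "corner \<Sigma>\<^sub>1 \<Sigma>\<^sub>2 ?q ?p = b"
    by (rule point_eqI) (use P pq in \<open>simp_all add: corner\<close>)
  ultimately have s: "circle_sym P \<Sigma>\<^sub>1 \<Sigma>\<^sub>2 K ?p = ?q"
    using circle_sym_eqI[OF K pq] abc by simp
  then have "?p \<notin> K" using circle_sym_fixed_iff[OF K pq(1)] \<open>?p \<noteq> ?q\<close> by auto
  then have "circle_sym P \<Sigma>\<^sub>1 \<Sigma>\<^sub>2 K ?p = ?p" using S[OF K L(1), of ?p] L s by auto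
  with s \<open>?p \<noteq> ?q\<close> show False by simp
qed

end

end

(* Identify a circle K with the bijection k from the first to the second generator class, so that
   S_K (x, y) = (k^-1 y, k x). Orthogonality of N and K gives k n^-1 k = n, and the symmetry axiom
   makes every circle N through the opposite corners pq and qp orthogonal to every circle through
   p and q. Hence m^-1 n and m n^-1 intertwine all k for circles M, N through pq and qp, as well as
   t = k j^-1 i. These maps act transitively on the generators missing p and q, so the
   circle through p and q whose bijection agrees with t at one further generator agrees with it
   everywhere. Finally n l^-1 n = l for l = k j^-1 i moves n through the product and gives
   l^-1 = k^-1 j i^-1, which is what the other coordinate of S_K S_J S_I requires. *)
theory Submission imports Defs
begin

section \<open>Circles as bijections between the two generator classes\<close>

context hyperbola_structure
begin

abbreviation gen\<^sub>1 :: "'a \<Rightarrow> 'a set" where "gen\<^sub>1 \<equiv> gen_through \<Sigma>\<^sub>1"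
abbreviation gen\<^sub>2 :: "'a \<Rightarrow> 'a set" where "gen\<^sub>2 \<equiv> gen_through \<Sigma>\<^sub>2"

text \<open>The k of the overview. H3 makes the description meaningful for a circle \<open>K\<close>
  and a generator \<open>A\<close> of the first class; other arguments have no meaning.\<close>

definition circle_map :: "'a set \<Rightarrow> 'a set \<Rightarrow> 'a set"
  where "circle_map K A = gen\<^sub>2 (THE x. x \<in> A \<inter> K)"

text \<open>Defined through H3 like \<open>circle_map\<close>, so that the two classes play
  symmetric roles; that it is k^-1 follows below.\<close>

definition circle_inv :: "'a set \<Rightarrow> 'a set \<Rightarrow> 'a set"
  where "circle_inv K B = gen\<^sub>1 (THE x. x \<in> B \<inter> K)"

lemma circle_in_points: "K \<in> \<Lambda> \<Longrightarrow> x \<in> K \<Longrightarrow> x \<in> P"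
  using circles_subset by auto

lemma circle_map_gen1:
  assumes "K \<in> \<Lambda>" "x \<in> K"
  shows "circle_map K (gen\<^sub>1 x) = gen\<^sub>2 x"
proof -
  have "x \<in> gen\<^sub>1 x" "gen\<^sub>1 x \<in> \<Sigma>\<^sub>1" using gen1 circle_in_points[OF assms] by auto
  then have "(THE z. z \<in> gen\<^sub>1 x \<inter> K) = x"
    using H3[of "gen\<^sub>1 x" K] assms by (intro the1_equality) auto
  then show ?thesis by (simp add: circle_map_def)
qed

lemma circle_inv_gen2:
  assumes "K \<in> \<Lambda>" "x \<in> K"
  shows "circle_inv K (gen\<^sub>2 x) = gen\<^sub>1 x"
proof -
  have "x \<in> gen\<^sub>2 x" "gen\<^sub>2 x \<in> \<Sigma>\<^sub>2" using gen2 circle_in_points[OF assms] by auto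
  then have "(THE z. z \<in> gen\<^sub>2 x \<inter> K) = x"
    using H3[of "gen\<^sub>2 x" K] assms by (intro the1_equality) auto
  then show ?thesis by (simp add: circle_inv_def)
qed

lemma gen1_on_circle:
  assumes "K \<in> \<Lambda>" "A \<in> \<Sigma>\<^sub>1"
  obtains x where "x \<in> K" "gen\<^sub>1 x = A"
  using H3[of A K] assms gen1_eq circle_in_points by blast

lemma gen2_on_circle:
  assumes "K \<in> \<Lambda>" "B \<in> \<Sigma>\<^sub>2"
  obtains x where "x \<in> K" "gen\<^sub>2 x = B"
  using H3[of B K] assms gen2_eq circle_in_points by blast

lemma circle_map_in [simp]: "K \<in> \<Lambda> \<Longrightarrow> A \<in> \<Sigma>\<^sub>1 \<Longrightarrow> circle_map K A \<in> \<Sigma>\<^sub>2"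
  by (metis gen1_on_circle circle_map_gen1 circle_in_points gen2)

lemma circle_inv_in [simp]: "K \<in> \<Lambda> \<Longrightarrow> B \<in> \<Sigma>\<^sub>2 \<Longrightarrow> circle_inv K B \<in> \<Sigma>\<^sub>1"
  by (metis gen2_on_circle circle_inv_gen2 circle_in_points gen1)

lemma circle_inv_map [simp]: "K \<in> \<Lambda> \<Longrightarrow> A \<in> \<Sigma>\<^sub>1 \<Longrightarrow> circle_inv K (circle_map K A) = A"
  by (metis gen1_on_circle circle_map_gen1 circle_inv_gen2)

lemma circle_map_inv [simp]: "K \<in> \<Lambda> \<Longrightarrow> B \<in> \<Sigma>\<^sub>2 \<Longrightarrow> circle_map K (circle_inv K B) = B"
  by (metis gen2_on_circle circle_map_gen1 circle_inv_gen2)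

lemma point_with_gens:
  assumes "A \<in> \<Sigma>\<^sub>1" "B \<in> \<Sigma>\<^sub>2"
  obtains x where "x \<in> P" "gen\<^sub>1 x = A" "gen\<^sub>2 x = B"
proof -
  obtain x where x: "x \<in> A" "x \<in> B" using H2[OF assms] by blast
  moreover from this have "x \<in> P" using assms gens1_subset by blast
  ultimately show thesis using that gen1_eq gen2_eq assms by blast
qed

lemma mem_circle_iff:
  assumes "K \<in> \<Lambda>" "x \<in> P"
  shows "x \<in> K \<longleftrightarrow> circle_map K (gen\<^sub>1 x) = gen\<^sub>2 x"
proof
  assume eq: "circle_map K (gen\<^sub>1 x) = gen\<^sub>2 x"
  obtain z where z: "z \<in> K" "gen\<^sub>1 z = gen\<^sub>1 x"
    using gen1_on_circle assms gen1 by blast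
  then have "z = x"
    using eq assms circle_map_gen1[of K z] circle_in_points by (intro point_eqI) auto
  with z show "x \<in> K" by simp
qed (use assms circle_map_gen1 in blast)

text \<open>The corners of \<open>x\<close> and its image lie on \<open>K\<close>, and each pairs a
  generator of \<open>x\<close> with one of the image. Reading both incidences as values of k and
  k^-1 gives S_K in coordinates.\<close>

lemma circle_sym_gens:
  assumes "K \<in> \<Lambda>" "x \<in> P"
  shows circle_sym_in: "circle_sym P \<Sigma>\<^sub>1 \<Sigma>\<^sub>2 K x \<in> P"
    and circle_sym_gen1: "gen\<^sub>1 (circle_sym P \<Sigma>\<^sub>1 \<Sigma>\<^sub>2 K x) = circle_inv K (gen\<^sub>2 x)"
    and circle_sym_gen2: "gen\<^sub>2 (circle_sym P \<Sigma>\<^sub>1 \<Sigma>\<^sub>2 K x) = circle_map K (gen\<^sub>1 x)"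
proof -
  let ?y = "circle_sym P \<Sigma>\<^sub>1 \<Sigma>\<^sub>2 K x"
  have y: "?y \<in> P" "corner \<Sigma>\<^sub>1 \<Sigma>\<^sub>2 x ?y \<in> K" "corner \<Sigma>\<^sub>1 \<Sigma>\<^sub>2 ?y x \<in> K"
    using theI'[OF circle_sym_ex1[OF assms], folded circle_sym_def] by auto
  show "?y \<in> P" by (fact y)
  show "gen\<^sub>1 ?y = circle_inv K (gen\<^sub>2 x)"
    using circle_inv_gen2[OF assms(1) y(3)] y(1) assms by (simp add: corner)
  show "gen\<^sub>2 ?y = circle_map K (gen\<^sub>1 x)"
    using circle_map_gen1[OF assms(1) y(2)] y(1) assms by (simp add: corner)
qed

text \<open>The point (A, k A) of \<open>K\<close> is sent by S_N to (n^-1 k A, n A). Since the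
  image is again on \<open>K\<close>, applying k to its first coordinate gives its second.\<close>

lemma orthogonal_circle_map:
  assumes "N \<in> \<Lambda>" "K \<in> \<Lambda>" "orthogonal P \<Sigma>\<^sub>1 \<Sigma>\<^sub>2 N K" "A \<in> \<Sigma>\<^sub>1"
  shows "circle_map K (circle_inv N (circle_map K A)) = circle_map N A"
proof -
  obtain z where z: "z \<in> K" "gen\<^sub>1 z = A" using gen1_on_circle assms by blast
  then have "circle_sym P \<Sigma>\<^sub>1 \<Sigma>\<^sub>2 N z \<in> K" using assms(3) unfolding orthogonal_def by blast
  moreover have "z \<in> P" using circle_in_points z assms by blast
  ultimately show ?thesis
    using mem_circle_iff[OF assms(2) circle_sym_in] circle_sym_gens[OF assms(1)]
      circle_map_gen1[OF assms(2) z(1)] z(2) assms(1) by metis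
qed

text \<open>Apply k^-1 to both sides of k n^-1 k = n. The companion
  \<open>orthogonal_map_inv\<close> instead composes with k^-1 on the right.\<close>

lemma orthogonal_inv_map:
  assumes "N \<in> \<Lambda>" "K \<in> \<Lambda>" "orthogonal P \<Sigma>\<^sub>1 \<Sigma>\<^sub>2 N K" "A \<in> \<Sigma>\<^sub>1"
  shows "circle_inv N (circle_map K A) = circle_inv K (circle_map N A)"
  using assms by (simp flip: orthogonal_circle_map[OF assms])

lemma orthogonal_map_inv:
  assumes "N \<in> \<Lambda>" "K \<in> \<Lambda>" "orthogonal P \<Sigma>\<^sub>1 \<Sigma>\<^sub>2 N K" "B \<in> \<Sigma>\<^sub>2"
  shows "circle_map K (circle_inv N B) = circle_map N (circle_inv K B)"
  using orthogonal_circle_map[OF assms(1,2,3), of "circle_inv K B"] assms by simp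

lemma circle_through:
  assumes "a \<in> P" "b \<in> P" "c \<in> P"
    and "gen\<^sub>1 a \<noteq> gen\<^sub>1 b" "gen\<^sub>1 b \<noteq> gen\<^sub>1 c" "gen\<^sub>1 c \<noteq> gen\<^sub>1 a"
    and "gen\<^sub>2 a \<noteq> gen\<^sub>2 b" "gen\<^sub>2 b \<noteq> gen\<^sub>2 c" "gen\<^sub>2 c \<noteq> gen\<^sub>2 a"
  obtains K where "K \<in> \<Lambda>" "a \<in> K" "b \<in> K" "c \<in> K"
  using H4[OF assms(1-3)] assms(4-) by fastforce

lemma circle_map_inj:
  "K \<in> \<Lambda> \<Longrightarrow> A \<in> \<Sigma>\<^sub>1 \<Longrightarrow> A' \<in> \<Sigma>\<^sub>1 \<Longrightarrow> circle_map K A = circle_map K A' \<longleftrightarrow> A = A'"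
  by (metis circle_inv_map)

lemma circle_inv_inj:
  "K \<in> \<Lambda> \<Longrightarrow> B \<in> \<Sigma>\<^sub>2 \<Longrightarrow> B' \<in> \<Sigma>\<^sub>2 \<Longrightarrow> circle_inv K B = circle_inv K B' \<longleftrightarrow> B = B'"
  by (metis circle_map_inv)

text \<open>In coordinates the product sends (x, y) to (k^-1 j i^-1 y, k j^-1 i x). The two
  equations for \<open>L\<close> are not formally equivalent: inverting the first one would give
  i^-1 j k^-1.\<close>

lemma circle_sym_triple:
  assumes "I \<in> \<Lambda>" "J \<in> \<Lambda>" "K \<in> \<Lambda>" "L \<in> \<Lambda>"
    and "\<And>A. A \<in> \<Sigma>\<^sub>1 \<Longrightarrow> circle_map L A = circle_map K (circle_inv J (circle_map I A))"
    and "\<And>B. B \<in> \<Sigma>\<^sub>2 \<Longrightarrow> circle_inv L B = circle_inv K (circle_map J (circle_inv I B))"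
    and x: "x \<in> P"
  shows "circle_sym P \<Sigma>\<^sub>1 \<Sigma>\<^sub>2 L x =
    circle_sym P \<Sigma>\<^sub>1 \<Sigma>\<^sub>2 K (circle_sym P \<Sigma>\<^sub>1 \<Sigma>\<^sub>2 J (circle_sym P \<Sigma>\<^sub>1 \<Sigma>\<^sub>2 I x))"
  by (rule point_eqI) (use assms gen1 gen2 in \<open>simp_all add: circle_sym_gens\<close>)

end

section \<open>Consequences of the symmetry axiom for circles through p and q\<close>

context symmetric_minkowski_plane
begin

text \<open>Containing both corners means that S_N maps \<open>p\<close> to \<open>q\<close>, so
  \<open>p\<close> is a point of \<open>K\<close> outside \<open>N\<close> whose image is on
  \<open>K\<close>, as the symmetry axiom requires.\<close>

lemma orthogonal_opposite_corners:
  assumes "p \<in> P" "q \<in> P" "gen\<^sub>1 p \<noteq> gen\<^sub>1 q"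
    and K: "K \<in> \<Lambda>" "p \<in> K" "q \<in> K"
    and N: "N \<in> \<Lambda>" "corner \<Sigma>\<^sub>1 \<Sigma>\<^sub>2 p q \<in> N" "corner \<Sigma>\<^sub>1 \<Sigma>\<^sub>2 q p \<in> N"
  shows "orthogonal P \<Sigma>\<^sub>1 \<Sigma>\<^sub>2 N K"
proof (rule symmetry[OF N(1) K(1)])
  have "p \<notin> N"
  proof
    assume "p \<in> N"
    \<comment> \<open>Both points are on \<open>N\<close> and share their second generator.\<close>
    then have "p = corner \<Sigma>\<^sub>1 \<Sigma>\<^sub>2 q p"
      using circle_point_eqI[OF N(1) _ N(3)] assms by (simp add: corner)
    then show False using assms by (metis corner_gen1)
  qed
  then show "p \<in> K - N" using K by simp
  show "circle_sym P \<Sigma>\<^sub>1 \<Sigma>\<^sub>2 N p \<in> K"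
    using circle_sym_eqI[OF N(1) assms(1,2) N(2,3)] K by simp
qed

text \<open>Source of the transitivity: H4 is applied to the two corners and the point with
  generators \<open>A\<close> and \<open>B\<close>.\<close>

lemma circle_through_opposite_corners:
  assumes "p \<in> P" "q \<in> P" "gen\<^sub>1 p \<noteq> gen\<^sub>1 q" "gen\<^sub>2 p \<noteq> gen\<^sub>2 q"
    and "A \<in> \<Sigma>\<^sub>1 - {gen\<^sub>1 p, gen\<^sub>1 q}" "B \<in> \<Sigma>\<^sub>2 - {gen\<^sub>2 p, gen\<^sub>2 q}"
  obtains N where "N \<in> \<Lambda>" "corner \<Sigma>\<^sub>1 \<Sigma>\<^sub>2 p q \<in> N" "corner \<Sigma>\<^sub>1 \<Sigma>\<^sub>2 q p \<in> N" "circle_map N A = B"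
proof -
  obtain z where z: "z \<in> P" "gen\<^sub>1 z = A" "gen\<^sub>2 z = B" using point_with_gens assms by blast
  obtain N where "N \<in> \<Lambda>" "corner \<Sigma>\<^sub>1 \<Sigma>\<^sub>2 p q \<in> N" "corner \<Sigma>\<^sub>1 \<Sigma>\<^sub>2 q p \<in> N" "z \<in> N"
    by (rule circle_through[of "corner \<Sigma>\<^sub>1 \<Sigma>\<^sub>2 p q" "corner \<Sigma>\<^sub>1 \<Sigma>\<^sub>2 q p" z])
      (use assms z in \<open>auto simp: corner\<close>)
  then show thesis using that z circle_map_gen1 by blast
qed

lemma triple_circle_map:
  assumes pq: "p \<in> P" "q \<in> P" "gen\<^sub>1 p \<noteq> gen\<^sub>1 q" "gen\<^sub>2 p \<noteq> gen\<^sub>2 q"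
    and I: "I \<in> \<Lambda>" "p \<in> I" "q \<in> I"
    and J: "J \<in> \<Lambda>" "p \<in> J" "q \<in> J"
    and K: "K \<in> \<Lambda>" "p \<in> K" "q \<in> K"
    and L: "L \<in> \<Lambda>" "p \<in> L" "q \<in> L"
    and A: "A \<in> \<Sigma>\<^sub>1 - {gen\<^sub>1 p, gen\<^sub>1 q}"
    and LA: "circle_map L A = circle_map K (circle_inv J (circle_map I A))"
    and C: "C \<in> \<Sigma>\<^sub>1"
  shows "circle_map L C = circle_map K (circle_inv J (circle_map I C))"
proof (cases "C \<in> {gen\<^sub>1 p, gen\<^sub>1 q}")
  case True
  then show ?thesis
    using I J K L by (auto simp: circle_map_gen1 circle_inv_gen2)
next
  case False
  \<comment> \<open>Any second generator missing \<open>p\<close> and \<open>q\<close> would serve;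
    injectivity of i supplies this one.\<close>
  define B where "B = circle_map I A"
  have "B \<noteq> gen\<^sub>2 p" "B \<noteq> gen\<^sub>2 q"
    unfolding B_def using A I pq gen1 circle_map_inj[of I A "gen\<^sub>1 p"] circle_map_inj[of I A "gen\<^sub>1 q"]
    by (auto simp: circle_map_gen1)
  then have B: "B \<in> \<Sigma>\<^sub>2 - {gen\<^sub>2 p, gen\<^sub>2 q}" using A I B_def by auto
  obtain N where N: "N \<in> \<Lambda>" "corner \<Sigma>\<^sub>1 \<Sigma>\<^sub>2 p q \<in> N" "corner \<Sigma>\<^sub>1 \<Sigma>\<^sub>2 q p \<in> N" "circle_map N A = B"
    using circle_through_opposite_corners[OF pq A B] by blast
  obtain M where M: "M \<in> \<Lambda>" "corner \<Sigma>\<^sub>1 \<Sigma>\<^sub>2 p q \<in> M" "corner \<Sigma>\<^sub>1 \<Sigma>\<^sub>2 q p \<in> M" "circle_map M C = B"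
    using circle_through_opposite_corners[OF pq _ B, of C] C False by blast
  \<comment> \<open>Both n A and m C equal \<open>B\<close>, so m^-1 n carries \<open>A\<close> to
    the arbitrary \<open>C\<close>.\<close>
  have CA: "C = circle_inv M (circle_map N A)" using N M C by (metis circle_inv_map)
  note NO = orthogonal_opposite_corners[OF pq(1-3) _ _ _ N(1-3)]
  note MO = orthogonal_opposite_corners[OF pq(1-3) _ _ _ M(1-3)]
  note mi = orthogonal_map_inv[OF M(1) _ MO] and nm = orthogonal_inv_map[OF N(1) _ NO]
  note mm = orthogonal_inv_map[OF M(1) _ MO] and ni = orthogonal_map_inv[OF N(1) _ NO]
  have A': "A \<in> \<Sigma>\<^sub>1" using A by simp
  \<comment> \<open>By the two orthogonalities, e m^-1 n = m e^-1 n = m n^-1 e; the inverse version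
    below is analogous.\<close>
  have intertwine: "circle_map E (circle_inv M (circle_map N D)) =
      circle_map M (circle_inv N (circle_map E D))"
    if "E \<in> \<Lambda>" "p \<in> E" "q \<in> E" "D \<in> \<Sigma>\<^sub>1" for E D
    using that mi[of E "circle_map N D"] nm[of E D] N M by simp
  have intertwine': "circle_inv E (circle_map M (circle_inv N D)) =
      circle_inv M (circle_map N (circle_inv E D))"
    if "E \<in> \<Lambda>" "p \<in> E" "q \<in> E" "D \<in> \<Sigma>\<^sub>2" for E D
    using that mm[of E "circle_inv N D"] ni[of E D] N M by simp
  \<comment> \<open>Moving m^-1 n leftwards past i, j^-1 and k turns it into m n^-1, then m^-1 n,
    then m n^-1. It also becomes m n^-1 past l, so agreement at \<open>A\<close> passes to
    \<open>C\<close>.\<close>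
  show ?thesis
    unfolding CA using A' I J K L LA by (simp add: intertwine intertwine')
qed

lemma triple_circle:
  assumes pq: "p \<in> P" "q \<in> P" "gen\<^sub>1 p \<noteq> gen\<^sub>1 q" "gen\<^sub>2 p \<noteq> gen\<^sub>2 q"
    and I: "I \<in> \<Lambda>" "p \<in> I" "q \<in> I"
    and J: "J \<in> \<Lambda>" "p \<in> J" "q \<in> J"
    and K: "K \<in> \<Lambda>" "p \<in> K" "q \<in> K"
  shows "\<exists>L\<in>\<Lambda>. p \<in> L \<and> q \<in> L \<and>
    (\<forall>C\<in>\<Sigma>\<^sub>1. circle_map L C = circle_map K (circle_inv J (circle_map I C)))"
proof (cases "\<Sigma>\<^sub>1 \<subseteq> {gen\<^sub>1 p, gen\<^sub>1 q}")
  case True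
  have "circle_map I C = circle_map K (circle_inv J (circle_map I C))" if "C \<in> \<Sigma>\<^sub>1" for C
    using that True I J K by (auto simp: circle_map_gen1 circle_inv_gen2 dest!: subsetD[OF True])
  then show ?thesis using I by blast
next
  case False
  then obtain A where A: "A \<in> \<Sigma>\<^sub>1 - {gen\<^sub>1 p, gen\<^sub>1 q}" by blast
  let ?t = "\<lambda>A. circle_map K (circle_inv J (circle_map I A))"
  \<comment> \<open>Injectivity of t keeps its value at \<open>A\<close> off the generators of
    \<open>p\<close> and \<open>q\<close>, so H4 yields a circle through \<open>p\<close>,
    \<open>q\<close> and (A, t A).\<close>
  have "?t A \<noteq> ?t (gen\<^sub>1 x)" if "x \<in> {p, q}" for x
    using that A I J K pq gen1 by (auto simp: circle_map_inj circle_inv_inj)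
  moreover have "?t (gen\<^sub>1 x) = gen\<^sub>2 x" if "x \<in> {p, q}" for x
    using that I J K by (auto simp: circle_map_gen1 circle_inv_gen2)
  ultimately have t: "?t A \<noteq> gen\<^sub>2 p" "?t A \<noteq> gen\<^sub>2 q" by fastforce+
  have "?t A \<in> \<Sigma>\<^sub>2" using A I J K by simp
  then obtain z where z: "z \<in> P" "gen\<^sub>1 z = A" "gen\<^sub>2 z = ?t A"
    using point_with_gens A by blast
  obtain L where L: "L \<in> \<Lambda>" "p \<in> L" "q \<in> L" "z \<in> L"
    by (rule circle_through[of p q z]) (use pq z A t in auto)
  then have "circle_map L A = ?t A" using circle_map_gen1 z by metis
  then show ?thesis using triple_circle_map[OF pq I J K L(1-3) A] L by blast
qed

text \<open>Writing B = n D for a circle \<open>N\<close> through the opposite corners, n passes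
  through each factor by n^-1 k = k^-1 n or k n^-1 = n k^-1, inverting that factor on the
  way.\<close>

lemma triple_circle_inv:
  assumes pq: "p \<in> P" "q \<in> P" "gen\<^sub>1 p \<noteq> gen\<^sub>1 q" "gen\<^sub>2 p \<noteq> gen\<^sub>2 q"
    and I: "I \<in> \<Lambda>" "p \<in> I" "q \<in> I"
    and J: "J \<in> \<Lambda>" "p \<in> J" "q \<in> J"
    and K: "K \<in> \<Lambda>" "p \<in> K" "q \<in> K"
    and L: "L \<in> \<Lambda>" "p \<in> L" "q \<in> L"
    and eq: "\<And>A. A \<in> \<Sigma>\<^sub>1 \<Longrightarrow> circle_map L A = circle_map K (circle_inv J (circle_map I A))"
    and B: "B \<in> \<Sigma>\<^sub>2"
  shows "circle_inv L B = circle_inv K (circle_map J (circle_inv I B))"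
proof (cases "B \<in> {gen\<^sub>2 p, gen\<^sub>2 q}")
  case True
  then show ?thesis
    using I J K L by (auto simp: circle_map_gen1 circle_inv_gen2)
next
  case False
  \<comment> \<open>Supplies the first generator missing \<open>p\<close> and \<open>q\<close> from
    which \<open>N\<close> is obtained.\<close>
  define A where "A = circle_inv I B"
  have "A \<noteq> gen\<^sub>1 p" "A \<noteq> gen\<^sub>1 q"
    using False I B circle_map_gen1 circle_map_inv A_def by (metis insertCI)+
  then have "A \<in> \<Sigma>\<^sub>1 - {gen\<^sub>1 p, gen\<^sub>1 q}" using B I A_def by simp
  then obtain N where N: "N \<in> \<Lambda>" "corner \<Sigma>\<^sub>1 \<Sigma>\<^sub>2 p q \<in> N" "corner \<Sigma>\<^sub>1 \<Sigma>\<^sub>2 q p \<in> N"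
    using circle_through_opposite_corners[OF pq, of A B] B False by blast
  note NO = orthogonal_opposite_corners[OF pq(1-3) _ _ _ N(1-3)]
  note im = orthogonal_inv_map[OF N(1) _ NO] and mi = orthogonal_map_inv[OF N(1) _ NO]
  define D where "D = circle_inv N B"
  have D: "D \<in> \<Sigma>\<^sub>1" "B = circle_map N D" using B N by (simp_all add: D_def)
  have "circle_inv L B = circle_inv N (circle_map L D)"
    using D L by (simp add: im)
  also have "\<dots> = circle_inv N (circle_map K (circle_inv J (circle_map I D)))"
    using D eq by simp
  also have "\<dots> = circle_inv K (circle_map N (circle_inv J (circle_map I D)))"
    using D I J K by (simp add: im)
  also have "\<dots> = circle_inv K (circle_map J (circle_inv N (circle_map I D)))"
    using D I J by (simp add: mi)
  also have "\<dots> = circle_inv K (circle_map J (circle_inv I B))"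
    using D I by (simp add: im)
  finally show ?thesis .
qed

end

theorem theorem2p2:
  fixes P :: "'a set" and \<Lambda> \<Sigma>\<^sub>1 \<Sigma>\<^sub>2 :: "'a set set"
    and p q :: 'a and I J K :: "'a set"
  assumes "symmetric_minkowski_plane P \<Lambda> \<Sigma>\<^sub>1 \<Sigma>\<^sub>2"
    and "p \<in> P" and "q \<in> P"
    and "p \<notin> gen_through \<Sigma>\<^sub>1 q \<union> gen_through \<Sigma>\<^sub>2 q"
    and "I \<in> \<Lambda>" and "p \<in> I" and "q \<in> I"
    and "J \<in> \<Lambda>" and "p \<in> J" and "q \<in> J"
    and "K \<in> \<Lambda>" and "p \<in> K" and "q \<in> K"
  shows "\<exists>L\<in>\<Lambda>. p \<in> L \<and> q \<in> L \<and>
    (\<forall>x\<in>P. circle_sym P \<Sigma>\<^sub>1 \<Sigma>\<^sub>2 L x =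
      (circle_sym P \<Sigma>\<^sub>1 \<Sigma>\<^sub>2 K \<circ> circle_sym P \<Sigma>\<^sub>1 \<Sigma>\<^sub>2 J \<circ> circle_sym P \<Sigma>\<^sub>1 \<Sigma>\<^sub>2 I) x)"
proof -
  interpret symmetric_minkowski_plane P \<Lambda> \<Sigma>\<^sub>1 \<Sigma>\<^sub>2 by fact
  have ne: "gen\<^sub>1 p \<noteq> gen\<^sub>1 q" "gen\<^sub>2 p \<noteq> gen\<^sub>2 q" using assms(2-4) gen1 gen2 by blast+
  then obtain L where "L \<in> \<Lambda>" "p \<in> L" "q \<in> L"
    "\<And>C. C \<in> \<Sigma>\<^sub>1 \<Longrightarrow> circle_map L C = circle_map K (circle_inv J (circle_map I C))"
    using triple_circle[OF assms(2,3) ne assms(5-13)] by blast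
  moreover from this have
    "\<And>B. B \<in> \<Sigma>\<^sub>2 \<Longrightarrow> circle_inv L B = circle_inv K (circle_map J (circle_inv I B))"
    using triple_circle_inv[OF assms(2,3) ne assms(5-13)] by blast
  ultimately show ?thesis using circle_sym_triple[OF assms(5,8,11)] by auto
qed

end
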